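(* Let $(Y_\lambda,\lambda\ge0)$ be a centered MRL process. Let $\Lambda:=(\Lambda_t,t\ge0)$ be an $\mathbb{R}_+$-valued Markov process which satisfies the following conditions: i) $\Lambda$ is homogeneous, right-continuous, and started at $0$; ii) the transition kernel of $\Lambda$ has the form $P_t(\theta,d\lambda)=p_t(\theta,\lambda)\,d\lambda$, where, for every $t>0$, $p_t$ is continuous and TP$_2$ on $\mathbb{R}_+\times\mathbb{R}_+$; iii) $\Lambda$ is independent of $(Y_\lambda,\lambda\ge0)$ and, for every $t\ge0$, $\mathbb{E}\left[\left|Y_{\Lambda_t}\right|\right]<\infty$. Then the subordinated process $(X_t:=Y_{\Lambda_t},t\ge0)$ is a centered MRL process.
   Context: $\mathbb{R}_+=[0,+\infty)$. A function $p:I\times J\to\mathbb{R}_+$ ($I,J\subset\mathbb{R}$ intervals) is TP$_2$ (totally positive of order 2) if $p(x_1,y_1)p(x_2,y_2)-p(x_1,y_2)p(x_2,y_1)\ge0$ for all $x_1\le x_2$ in $I$ and $y_1\le y_2$ in $J$. For an integrable random variable with law $\mu$, put $b_\mu=\inf\{z\in\mathbb{R}:\mu([z,+\infty[)=0\}$ (with $\inf\emptyset=+\infty$) and define its MRL function by $L_\mu(x)=\frac{1}{\mu([x,+\infty[)}\int_{[x,+\infty[}(y-x)\mu(dy)$ if $x<b_\mu$ and $L_\mu(x)=0$ otherwise. An MRL process is an integrable real-valued process $(Z_t,t\ge0)$ (i.e. $\mathbb{E}|Z_t|<\infty$ for all $t$) increasing in the MRL order: for all $0\le s\le t$ and $x\in\mathbb{R}$,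 $L_{\mu_s}(x)\le L_{\mu_t}(x)$, where $\mu_t$ is the law of $Z_t$. It is centered if $\mathbb{E}[Z_t]=0$ for all $t$.
   Formalization: Independence of Λ and Y is strengthened: (λ,ω)↦Y_λ(ω) must be jointly measurable for a sigma-algebra on Ω independent of Λ. With bare independence the claim fails: for Y_λ=1_{Λ_1=λ}, each Y_λ is a.s. 0 but Y_{Λ_1}=1. *)

theory Defs
  imports "HOL-Probability.Probability"
begin

text \<open>Processes indexed by \<open>[0, \<infinity>)\<close> are functions \<open>real \<Rightarrow> 'a \<Rightarrow> 'b\<close> that are only constrained at
  non-negative times.\<close>

definition TP2_on :: "real set \<Rightarrow> real set \<Rightarrow> (real \<Rightarrow> real \<Rightarrow> real) \<Rightarrow> bool" where
  "TP2_on I J p \<longleftrightarrow>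
     (\<forall>x\<in>I. \<forall>y\<in>J. 0 \<le> p x y) \<and>
     (\<forall>x1\<in>I. \<forall>x2\<in>I. \<forall>y1\<in>J. \<forall>y2\<in>J. x1 \<le> x2 \<longrightarrow> y1 \<le> y2 \<longrightarrow>
        p x1 y1 * p x2 y2 - p x1 y2 * p x2 y1 \<ge> 0)"


text \<open>The infimum is taken in \<open>ereal\<close>, so that it is \<open>\<infinity>\<close> for the empty set.\<close>

definition mrl_endpoint :: "real measure \<Rightarrow> ereal" where
  "mrl_endpoint \<mu> = Inf {ereal z | z. measure \<mu> {z..} = 0}"

definition MRL :: "real measure \<Rightarrow> real \<Rightarrow> real" where
  "MRL \<mu> x =
     (if ereal x < mrl_endpoint \<mu>
      then (1 / measure \<mu> {x..}) * (LINT y:{x..}|\<mu>. y - x)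
      else 0)"

definition mrl_process :: "'a measure \<Rightarrow> (real \<Rightarrow> 'a \<Rightarrow> real) \<Rightarrow> bool" where
  "mrl_process M Z \<longleftrightarrow>
     (\<forall>t\<ge>0. integrable M (Z t)) \<and>
     (\<forall>s t x. 0 \<le> s \<longrightarrow> s \<le> t \<longrightarrow>
        MRL (distr M borel (Z s)) x \<le> MRL (distr M borel (Z t)) x)"

definition centered_process :: "'a measure \<Rightarrow> (real \<Rightarrow> 'a \<Rightarrow> real) \<Rightarrow> bool" where
  "centered_process M Z \<longleftrightarrow> (\<forall>t\<ge>0. integral\<^sup>L M (Z t) = 0)"


abbreviation Rplus :: "real measure" where
  "Rplus \<equiv> restrict_space borel {0..}"

definition generated_sigma ::
  "'a measure \<Rightarrow> 'b measure \<Rightarrow> ('t \<Rightarrow> 'a \<Rightarrow> 'b) \<Rightarrow> 't set \<Rightarrow> 'a measure" where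
  "generated_sigma M S X T = sigma (space M) (\<Union>t\<in>T. {X t -` A \<inter> space M | A. A \<in> sets S})"

text \<open>Homogeneous Markov process with state space \<open>S\<close> and transition kernel \<open>P\<close>, with respect to its
  natural filtration. The lag \<open>t\<close> is restricted to \<open>t > 0\<close>, since for \<open>t = 0\<close> the Markov property
  merely says that \<open>P\<^sub>0\<close> is the identity kernel; \<open>P 0\<close> is left unconstrained.\<close>

definition homogeneous_markov_process ::
  "'a measure \<Rightarrow> 'b measure \<Rightarrow> (real \<Rightarrow> 'a \<Rightarrow> 'b) \<Rightarrow> (real \<Rightarrow> 'b \<Rightarrow> 'b measure) \<Rightarrow> bool" where
  "homogeneous_markov_process M S X P \<longleftrightarrow>
     (\<forall>t\<ge>0. X t \<in> measurable M S) \<and>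
     (\<forall>t>0. P t \<in> measurable S (prob_algebra S)) \<and>
     (\<forall>s\<ge>0. \<forall>t>0. \<forall>A\<in>sets S. AE \<omega> in M.
        real_cond_exp M (generated_sigma M S X {0..s}) (\<lambda>\<omega>. indicator A (X (s + t) \<omega>)) \<omega>
          = measure (P t (X s \<omega>)) A)"

definition right_continuous_process :: "'a measure \<Rightarrow> (real \<Rightarrow> 'a \<Rightarrow> real) \<Rightarrow> bool" where
  "right_continuous_process M X \<longleftrightarrow>
     (AE \<omega> in M. \<forall>t\<ge>0. continuous (at_right t) (\<lambda>s. X s \<omega>))"

text \<open>Independence of the processes \<open>\<Lambda>\<close> and \<open>Y\<close>, in the form needed to evaluate \<open>Y\<close> at the random
  times \<open>\<Lambda>\<^sub>t\<close>: the map \<open>(\<lambda>, \<omega>) \<mapsto> Y\<^sub>\<lambda>(\<omega>)\<close> is jointly measurable with respect to a sub-sigma-algebra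
  \<open>G\<close> that is independent of \<open>\<sigma>(\<Lambda>\<^sub>t, t \<ge> 0)\<close>. Joint measurability forces \<open>\<sigma>(Y\<^sub>\<lambda>, \<lambda> \<ge> 0) \<subseteq> G\<close>, so
  this includes independence of the generated sigma-algebras. If \<open>Y\<close> is jointly measurable with
  respect to \<open>\<sigma>(Y\<^sub>\<lambda>, \<lambda> \<ge> 0)\<close> (for instance, if all its paths are right-continuous), one can take
  \<open>G = \<sigma>(Y\<^sub>\<lambda>, \<lambda> \<ge> 0)\<close> and the two notions coincide; if \<open>Y\<close> and \<open>\<Lambda>\<close> live on the two factors of a
  product space and \<open>Y\<close> is a measurable process, \<open>G\<close> is the sigma-algebra of the first factor.
  Independence of the generated sigma-algebras alone does not determine the law of \<open>Y\<close> at time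
  \<open>\<Lambda>\<^sub>t\<close>: if \<open>\<Lambda>\<^sub>1\<close> has a density and \<open>Y\<^sub>\<lambda>\<close> is the indicator of \<open>{\<Lambda>\<^sub>1 = \<lambda>}\<close>, then every
  \<open>Y\<^sub>\<lambda>\<close> vanishes almost surely, hence \<open>Y\<close> is independent of \<open>\<Lambda>\<close>, while \<open>Y\<close> at time \<open>\<Lambda>\<^sub>1\<close> is
  constantly \<open>1\<close>.\<close>

definition independent_processes ::
  "'a measure \<Rightarrow> (real \<Rightarrow> 'a \<Rightarrow> real) \<Rightarrow> (real \<Rightarrow> 'a \<Rightarrow> real) \<Rightarrow> bool" where
  "independent_processes M \<Lambda> Y \<longleftrightarrow>
     (\<exists>G. subalgebra M G \<and>
          (\<lambda>(l, \<omega>). Y l \<omega>) \<in> borel_measurable (Rplus \<Otimes>\<^sub>M G) \<and>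
          prob_space.indep_set M (sets (generated_sigma M Rplus \<Lambda> {0..})) (sets G))"

end

theory Submission
  imports Defs
begin

text \<open>
  For an integrable law \<open>\<mu>\<close> let \<open>C\<^sub>\<mu>(x) = \<integral> (y - x)\<^sup>+ d\<mu>(y)\<close>. Its left derivative is \<open>-\<mu>[x, \<infinity>)\<close>, and the
  MRL function is \<open>C\<^sub>\<mu>(x) / \<mu>[x, \<infinity>)\<close>, so \<open>L\<^sub>\<mu> \<le> L\<^sub>\<nu>\<close> says that \<open>C\<^sub>\<nu> / C\<^sub>\<mu>\<close> is nondecreasing wherever
  \<open>C\<^sub>\<mu> > 0\<close>. Hence a process is increasing in the MRL order if and only if \<open>(t, x) \<mapsto> \<integral> (Z\<^sub>t - x)\<^sup>+\<close> is
  TP\<open>\<^sub>2\<close> (\<open>MRL_le_iff_stop_loss_TP2\<close>, \<open>mrl_process_iff_excess_TP2\<close>).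

  Write \<open>c(\<lambda>, x)\<close> for this function of the process \<open>Y\<close> and \<open>\<nu>\<^sub>t\<close> for the law of \<open>\<Lambda>\<^sub>t\<close>. By independence, the
  function of \<open>X\<close> is \<open>\<integral> c(\<lambda>, x) \<nu>\<^sub>t(d\<lambda>)\<close> (\<open>excess_at_independent_time\<close>). For \<open>0 < s < t\<close> the Markov
  property and the start at \<open>0\<close> give \<open>\<nu>\<^sub>s = P\<^sub>s(0, \<cdot>)\<close> and \<open>\<nu>\<^sub>t = \<integral> P\<^sub>s(\<theta>, \<cdot>) \<nu>\<^bsub>t-s\<^esub>(d\<theta>)\<close>
  (\<open>markov_law_started_at\<close>, \<open>markov_law_bind\<close>). With \<open>A(\<theta>, x) = \<integral> p\<^sub>s(\<theta>, \<lambda>) c(\<lambda>, x) d\<lambda>\<close>, the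
  function of \<open>X\<close> at time \<open>s\<close> is \<open>A(0, x)\<close>, and at time \<open>t\<close> it is the \<open>\<nu>\<^bsub>t-s\<^esub>\<close>-average of \<open>A(\<theta>, x)\<close> over
  \<open>\<theta> \<ge> 0\<close>. The composition of the TP\<open>\<^sub>2\<close> kernels \<open>p\<^sub>s\<close> and \<open>c\<close> is TP\<open>\<^sub>2\<close> (\<open>TP2_composition\<close>), which for
  \<open>x \<le> y\<close> gives \<open>A(0, y) A(\<theta>, x) \<le> A(0, x) A(\<theta>, y)\<close>; averaging over \<open>\<theta>\<close> yields the TP\<open>\<^sub>2\<close> inequality
  for \<open>X\<close>. For \<open>s = 0\<close>, \<open>X\<^sub>0 = Y\<^sub>0\<close> almost surely, and the inequality for \<open>Y\<close> at the times \<open>0 \<le> \<lambda>\<close> is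
  averaged over \<open>\<nu>\<^sub>t\<close>. Centering is Fubini's theorem (\<open>integral_at_independent_time\<close>).
\<close>

section \<open>The MRL order and total positivity of stop-loss transforms\<close>

text \<open>The stop-loss transform \<open>x \<mapsto> \<integral> (y - x)\<^sup>+ d\<mu>(y)\<close>.\<close>

definition stop_loss :: "real measure \<Rightarrow> real \<Rightarrow> real" where
  "stop_loss \<mu> x = (LINT y|\<mu>. max 0 (y - x))"

lemma stop_loss_nonneg: "0 \<le> stop_loss \<mu> x"
  unfolding stop_loss_def by (intro Bochner_Integration.integral_nonneg) auto

lemma ennreal_stop_loss:
  assumes "real_distribution \<mu>" "integrable \<mu> (\<lambda>y. y)"
  shows "ennreal (stop_loss \<mu> x) = (\<integral>\<^sup>+ y. ennreal (y - x) \<partial>\<mu>)"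
proof -
  interpret real_distribution \<mu> by fact
  have "integrable \<mu> (\<lambda>y. max 0 (y - x))"
    using assms(2) by (intro integrable_max) auto
  hence "ennreal (stop_loss \<mu> x) = (\<integral>\<^sup>+ y. ennreal (max 0 (y - x)) \<partial>\<mu>)"
    unfolding stop_loss_def by (subst nn_integral_eq_integral) auto
  also have "\<dots> = (\<integral>\<^sup>+ y. ennreal (y - x) \<partial>\<mu>)"
    by (intro nn_integral_cong) (auto simp: max_def ennreal_neg)
  finally show ?thesis .
qed

text \<open>The integrated form of \<open>C\<^sub>\<mu>' = -\<mu>[\<cdot>, \<infinity>)\<close>, where \<open>C\<^sub>\<mu>\<close> is the stop-loss transform of \<open>\<mu>\<close>.
  Positivity, continuity and the left derivative of \<open>C\<^sub>\<mu>\<close> are all read off from these two bounds.\<close>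

lemma stop_loss_diff_bounds:
  assumes "real_distribution \<mu>" "integrable \<mu> (\<lambda>y. y)" "a \<le> b"
  shows "measure \<mu> {b..} * (b - a) \<le> stop_loss \<mu> a - stop_loss \<mu> b"
    and "stop_loss \<mu> a - stop_loss \<mu> b \<le> measure \<mu> {a..} * (b - a)"
proof -
  interpret real_distribution \<mu> by fact
  have i: "integrable \<mu> (\<lambda>y. max 0 (y - x))" for x
    using assms(2) by (intro integrable_max) auto
  have ii: "integrable \<mu> (\<lambda>y. indicator {x..} y * (b - a))" for x
    by (intro integrable_mult_left integrable_real_indicator)
      (auto simp: emeasure_eq_measure)
  have int_ind: "(LINT y|\<mu>. indicator {x..} y * (b - a)) = measure \<mu> {x..} * (b - a)" for x
    by simp
  have eq: "stop_loss \<mu> a - stop_loss \<mu> b = (LINT y|\<mu>. max 0 (y - a) - max 0 (y - b))"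
    unfolding stop_loss_def by (subst Bochner_Integration.integral_diff) (auto simp: i)
  show "measure \<mu> {b..} * (b - a) \<le> stop_loss \<mu> a - stop_loss \<mu> b"
    unfolding eq int_ind[symmetric]
    by (intro integral_mono ii Bochner_Integration.integrable_diff i)
      (use assms(3) in \<open>auto simp: indicator_def max_def\<close>)
  show "stop_loss \<mu> a - stop_loss \<mu> b \<le> measure \<mu> {a..} * (b - a)"
    unfolding eq int_ind[symmetric]
    by (intro integral_mono ii Bochner_Integration.integrable_diff i)
      (use assms(3) in \<open>auto simp: indicator_def max_def\<close>)
qed

lemma stop_loss_antimono:
  assumes "real_distribution \<mu>" "integrable \<mu> (\<lambda>y. y)" "a \<le> b"
  shows "stop_loss \<mu> b \<le> stop_loss \<mu> a"
  using stop_loss_diff_bounds(1)[OF assms] assms(3)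
  by (smt (verit) measure_nonneg mult_nonneg_nonneg)

lemma stop_loss_eq_0:
  assumes "real_distribution \<mu>" "measure \<mu> {x..} = 0"
  shows "stop_loss \<mu> x = 0"
proof -
  interpret real_distribution \<mu> by fact
  have "{x..} \<in> null_sets \<mu>"
    using assms(2) by (auto simp: null_sets_def emeasure_eq_measure)
  hence "AE y in \<mu>. max 0 (y - x) = 0"
    by (rule AE_I') (auto simp: max_def)
  thus ?thesis
    unfolding stop_loss_def by (rule integral_eq_zero_AE)
qed

lemma stop_loss_pos_iff:
  assumes "real_distribution \<mu>" "integrable \<mu> (\<lambda>y. y)"
  shows "stop_loss \<mu> x > 0 \<longleftrightarrow> ereal x < mrl_endpoint \<mu>"
proof
  interpret real_distribution \<mu> by fact
  assume "ereal x < mrl_endpoint \<mu>"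
  then obtain w where w: "ereal x < ereal w" "ereal w < mrl_endpoint \<mu>"
    using ereal_dense2 by blast
  have "measure \<mu> {w..} \<noteq> 0"
  proof
    assume "measure \<mu> {w..} = 0"
    hence "mrl_endpoint \<mu> \<le> ereal w"
      unfolding mrl_endpoint_def by (intro Inf_lower) auto
    with w(2) show False by simp
  qed
  hence "0 < measure \<mu> {w..} * (w - x)"
    using w(1) by (simp add: zero_less_measure_iff)
  thus "stop_loss \<mu> x > 0"
    using stop_loss_diff_bounds(1)[OF assms, of x w] w(1) stop_loss_nonneg[of \<mu> w] by simp
next
  interpret real_distribution \<mu> by fact
  assume pos: "stop_loss \<mu> x > 0"
  show "ereal x < mrl_endpoint \<mu>"
  proof (rule ccontr)
    assume "\<not> ereal x < mrl_endpoint \<mu>"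
    \<comment> \<open>There is no mass above \<open>w\<close>, so \<open>stop_loss \<mu> x \<le> w - x\<close>, which is half of \<open>stop_loss \<mu> x\<close>.\<close>
    define w where "w = x + stop_loss \<mu> x / 2"
    have w: "x < w" using pos by (simp add: w_def)
    hence "mrl_endpoint \<mu> < ereal w"
      using \<open>\<not> ereal x < mrl_endpoint \<mu>\<close> by (meson less_ereal.simps(1) linorder_not_less order_le_less_trans)
    then obtain z where z: "measure \<mu> {z..} = 0" "z < w"
      unfolding mrl_endpoint_def by (auto simp: Inf_less_iff)
    have "measure \<mu> {w..} \<le> measure \<mu> {z..}"
      using z(2) by (intro finite_measure_mono) auto
    hence "measure \<mu> {w..} = 0" using z(1) by (simp add: measure_le_0_iff)
    hence "stop_loss \<mu> w = 0" by (rule stop_loss_eq_0[OF assms(1)])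
    hence "stop_loss \<mu> x \<le> measure \<mu> {x..} * (w - x)"
      using stop_loss_diff_bounds(2)[OF assms, of x w] w by simp
    also have "\<dots> \<le> 1 * (w - x)"
      using w by (intro mult_right_mono) auto
    finally show False using pos by (simp add: w_def)
  qed
qed

text \<open>No case distinction at the right endpoint is needed: there and beyond, the numerator vanishes,
  whether or not the endpoint is an atom, and division by zero gives zero.\<close>

lemma MRL_eq_stop_loss:
  assumes "real_distribution \<mu>" "integrable \<mu> (\<lambda>y. y)"
  shows "MRL \<mu> x = stop_loss \<mu> x / measure \<mu> {x..}"
proof -
  have "(LINT y:{x..}|\<mu>. y - x) = stop_loss \<mu> x"
    unfolding stop_loss_def set_lebesgue_integral_def
    by (intro Bochner_Integration.integral_cong) (auto simp: indicator_def)
  moreover have "stop_loss \<mu> x = 0" if "\<not> ereal x < mrl_endpoint \<mu>"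
    using that stop_loss_pos_iff[OF assms, of x] stop_loss_nonneg[of \<mu> x] by simp
  ultimately show ?thesis by (auto simp: MRL_def)
qed

lemma measure_atLeast_left_continuous:
  assumes "real_distribution \<mu>"
  shows "((\<lambda>y. measure \<mu> {y..}) \<longlongrightarrow> measure \<mu> {x..}) (at_left x)"
proof (rule tendsto_at_left_sequentially[of "x - 1"])
  interpret real_distribution \<mu> by fact
  fix S :: "nat \<Rightarrow> real"
  assume S: "\<And>n. S n < x" "incseq S" "S \<longlonglongrightarrow> x"
  have "(\<Inter>n. {S n..}) = {x..}"
  proof safe
    fix z assume "z \<in> (\<Inter>n. {S n..})"
    thus "x \<le> z" using S(3) by (intro LIMSEQ_le_const2) auto
  next
    fix z n assume "x \<le> z"
    thus "z \<ge> S n" using S(1)[of n] by simp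
  qed
  moreover have "(\<lambda>n. measure \<mu> {S n..}) \<longlonglongrightarrow> measure \<mu> (\<Inter>n. {S n..})"
    using S(2) by (intro finite_Lim_measure_decseq) (auto simp: decseq_def incseq_def)
  ultimately show "(\<lambda>n. measure \<mu> {S n..}) \<longlonglongrightarrow> measure \<mu> {x..}" by simp
qed simp

lemma stop_loss_left_derivative:
  assumes "real_distribution \<mu>" "integrable \<mu> (\<lambda>y. y)"
  shows "(stop_loss \<mu> has_real_derivative - measure \<mu> {x..}) (at_left x)"
  unfolding has_field_derivative_iff
proof (rule real_tendsto_sandwich)
  have "eventually (\<lambda>y. y < x) (at_left x)"
    by (simp add: eventually_at_filter)
  thus "\<forall>\<^sub>F y in at_left x. - measure \<mu> {y..} \<le> (stop_loss \<mu> y - stop_loss \<mu> x) / (y - x)"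
    by eventually_elim
      (use stop_loss_diff_bounds(2)[OF assms] in \<open>auto simp: field_simps\<close>)
  show "\<forall>\<^sub>F y in at_left x. (stop_loss \<mu> y - stop_loss \<mu> x) / (y - x) \<le> - measure \<mu> {x..}"
    using \<open>eventually (\<lambda>y. y < x) (at_left x)\<close>
    by eventually_elim
      (use stop_loss_diff_bounds(1)[OF assms] in \<open>auto simp: field_simps\<close>)
  show "((\<lambda>y. - measure \<mu> {y..}) \<longlongrightarrow> - measure \<mu> {x..}) (at_left x)"
    by (intro tendsto_intros measure_atLeast_left_continuous assms(1))
qed auto

lemma stop_loss_continuous_on:
  assumes "real_distribution \<mu>" "integrable \<mu> (\<lambda>y. y)"
  shows "continuous_on A (stop_loss \<mu>)"
proof -
  interpret real_distribution \<mu> by fact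
  have le: "\<bar>stop_loss \<mu> a - stop_loss \<mu> b\<bar> \<le> \<bar>a - b\<bar>" if "a \<le> b" for a b
  proof -
    have "stop_loss \<mu> a - stop_loss \<mu> b \<le> 1 * (b - a)"
      using stop_loss_diff_bounds(2)[OF assms that] that
      by (meson diff_ge_0_iff_ge mult_right_mono order_trans prob_le_1)
    thus ?thesis using stop_loss_antimono[OF assms that] that by simp
  qed
  have "1-lipschitz_on A (stop_loss \<mu>)"
    unfolding lipschitz_on_def dist_real_def
    using le by (metis abs_minus_commute linorder_le_cases mult_1 zero_le_one)
  thus ?thesis by (rule lipschitz_on_continuous_on)
qed

text \<open>One-sided differentiability suffices for monotonicity. After adding \<open>e * x\<close> with \<open>e > 0\<close>, the left
  derivative is positive; then the least point \<open>m\<close> of \<open>{x. g x \<le> g b}\<close> must be \<open>a\<close>, because \<open>g\<close> takes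
  smaller values just to the left of \<open>m\<close>.\<close>

lemma left_derivative_nonneg_imp_le:
  fixes f f' :: "real \<Rightarrow> real"
  assumes "a \<le> b" and cont: "continuous_on {a..b} f"
    and deriv: "\<And>x. a < x \<Longrightarrow> x \<le> b \<Longrightarrow> (f has_real_derivative f' x) (at_left x)"
    and nonneg: "\<And>x. a < x \<Longrightarrow> x \<le> b \<Longrightarrow> 0 \<le> f' x"
  shows "f a \<le> f b"
proof (cases "a = b")
  case False
  with assms(1) have "a < b" by simp
  have *: "f a + e * a \<le> f b + e * b" if e: "e > 0" for e
  proof -
    define g where "g x = f x + e * x" for x
    define S where "S = {x \<in> {a..b}. g x \<le> g b}"
    have g_cont: "continuous_on {a..b} g"
      unfolding g_def by (intro continuous_intros cont)
    have "closed S"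
      unfolding S_def by (intro continuous_on_closed_Collect_le g_cont continuous_intros)
    moreover have "S \<noteq> {}" "bdd_below S"
      using assms(1) by (auto simp: S_def intro!: bdd_belowI[of _ a])
    ultimately have m: "Inf S \<in> S" by (intro closed_contains_Inf)
    have "Inf S = a"
    proof (rule ccontr)
      assume "Inf S \<noteq> a"
      with m have am: "a < Inf S" "Inf S \<le> b" by (auto simp: S_def)
      have "(g has_real_derivative f' (Inf S) + e) (at_left (Inf S))"
        unfolding g_def using deriv[OF am] by (auto intro!: derivative_eq_intros)
      moreover have "f' (Inf S) + e > 0" using nonneg[OF am] e by simp
      ultimately obtain d where d: "d > 0"
        "\<And>h. h > 0 \<Longrightarrow> Inf S - h \<in> {..<Inf S} \<Longrightarrow> h < d \<Longrightarrow> g (Inf S - h) < g (Inf S)"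
        using has_real_derivative_pos_inc_left by metis
      define h where "h = min (d / 2) (Inf S - a)"
      have h: "h > 0" "h < d" "h \<le> Inf S - a" using d(1) am by (auto simp: h_def)
      have "g (Inf S - h) < g (Inf S)" using d(2)[of h] h by simp
      with m have "Inf S - h \<in> S" using h am by (auto simp: S_def)
      hence "Inf S \<le> Inf S - h" using \<open>bdd_below S\<close> by (rule cInf_lower)
      with h show False by simp
    qed
    with m show ?thesis by (simp add: S_def g_def)
  qed
  show ?thesis
  proof (rule field_le_epsilon)
    fix d :: real assume "d > 0"
    define e where "e = d / (b - a)"
    have "e > 0" "e * (b - a) = d"
      using \<open>a < b\<close> \<open>d > 0\<close> by (simp_all add: e_def)
    with *[of e] show "f a \<le> f b + d" by (simp add: right_diff_distrib)
  qed
qed simp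

text \<open>From left to right, the quotient of the stop-loss transforms has a nonnegative left derivative.
  From right to left, the inequality at \<open>y < x\<close> compares difference quotients, and \<open>y\<close> tends to \<open>x\<close>
  from the left.\<close>

lemma MRL_le_iff_stop_loss_TP2:
  assumes \<mu>: "real_distribution \<mu>" "integrable \<mu> (\<lambda>y. y)"
    and \<nu>: "real_distribution \<nu>" "integrable \<nu> (\<lambda>y. y)"
  shows "(\<forall>x. MRL \<mu> x \<le> MRL \<nu> x) \<longleftrightarrow>
    (\<forall>x y. x \<le> y \<longrightarrow> stop_loss \<mu> y * stop_loss \<nu> x \<le> stop_loss \<mu> x * stop_loss \<nu> y)"
proof
  assume mrl: "\<forall>x. MRL \<mu> x \<le> MRL \<nu> x"
  show "\<forall>x y. x \<le> y \<longrightarrow> stop_loss \<mu> y * stop_loss \<nu> x \<le> stop_loss \<mu> x * stop_loss \<nu> y"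
  proof (intro allI impI)
    fix x y :: real assume xy: "x \<le> y"
    show "stop_loss \<mu> y * stop_loss \<nu> x \<le> stop_loss \<mu> x * stop_loss \<nu> y"
    proof (cases "stop_loss \<mu> y = 0")
      case True
      thus ?thesis by (simp add: stop_loss_nonneg)
    next
      case False
      hence y: "stop_loss \<mu> y > 0" using stop_loss_nonneg[of \<mu> y] by simp
      have pos: "stop_loss \<mu> w > 0" if "w \<le> y" for w
        using stop_loss_antimono[OF \<mu> that] y by simp
      have "stop_loss \<nu> x / stop_loss \<mu> x \<le> stop_loss \<nu> y / stop_loss \<mu> y"
      proof (rule left_derivative_nonneg_imp_le[OF xy])
        show "continuous_on {x..y} (\<lambda>w. stop_loss \<nu> w / stop_loss \<mu> w)"
          using pos by (intro continuous_intros stop_loss_continuous_on \<mu> \<nu>) force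
      next
        fix w assume w: "x < w" "w \<le> y"
        show "((\<lambda>w. stop_loss \<nu> w / stop_loss \<mu> w) has_real_derivative
            (- measure \<nu> {w..} * stop_loss \<mu> w - stop_loss \<nu> w * - measure \<mu> {w..}) /
            (stop_loss \<mu> w * stop_loss \<mu> w)) (at_left w)"
          using pos[OF w(2)]
          by (intro DERIV_divide stop_loss_left_derivative \<mu> \<nu>) auto
        have T: "measure \<mu> {w..} > 0"
          using pos[OF w(2)] stop_loss_eq_0[OF \<mu>(1), of w] by (auto simp: zero_less_measure_iff)
        have le: "stop_loss \<mu> w / measure \<mu> {w..} \<le> stop_loss \<nu> w / measure \<nu> {w..}"
          using mrl by (simp add: MRL_eq_stop_loss \<mu> \<nu>)
        moreover have "0 < stop_loss \<mu> w / measure \<mu> {w..}" using T pos[OF w(2)] by simp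
        ultimately have "measure \<nu> {w..} \<noteq> 0" by auto
        hence "measure \<nu> {w..} > 0" by (simp add: zero_less_measure_iff)
        with le T have "measure \<nu> {w..} * stop_loss \<mu> w \<le> stop_loss \<nu> w * measure \<mu> {w..}"
          by (simp add: field_simps)
        thus "0 \<le> (- measure \<nu> {w..} * stop_loss \<mu> w - stop_loss \<nu> w * - measure \<mu> {w..}) /
            (stop_loss \<mu> w * stop_loss \<mu> w)"
          using pos[OF w(2)] by (intro divide_nonneg_pos) auto
      qed
      thus ?thesis using pos[of x] pos[of y] xy by (simp add: field_simps)
    qed
  qed
next
  assume tp: "\<forall>x y. x \<le> y \<longrightarrow> stop_loss \<mu> y * stop_loss \<nu> x \<le> stop_loss \<mu> x * stop_loss \<nu> y"
  show "\<forall>x. MRL \<mu> x \<le> MRL \<nu> x"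
  proof
    fix x
    show "MRL \<mu> x \<le> MRL \<nu> x"
    proof (cases "stop_loss \<mu> x = 0")
      case True
      thus ?thesis by (simp add: MRL_eq_stop_loss \<mu> \<nu> stop_loss_nonneg)
    next
      case False
      hence pos: "stop_loss \<mu> x > 0" using stop_loss_nonneg[of \<mu> x] by simp
      have "stop_loss \<nu> x \<noteq> 0"
      proof
        interpret \<nu>: real_distribution \<nu> by fact
        assume zero: "stop_loss \<nu> x = 0"
        \<comment> \<open>As \<open>stop_loss \<mu> x > 0\<close>, the assumed inequality makes \<open>stop_loss \<nu>\<close> vanish on \<open>(-\<infinity>, x]\<close>,
          but it is positive below the mean of \<open>\<nu>\<close>.\<close>
        define w where "w = min x ((LINT y|\<nu>. y) - 1)"
        have "stop_loss \<mu> x * stop_loss \<nu> w \<le> stop_loss \<mu> w * stop_loss \<nu> x"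
          using tp by (simp add: w_def)
        hence "stop_loss \<nu> w \<le> 0" using pos zero by (simp add: mult_le_0_iff)
        moreover have "(LINT y|\<nu>. y - w) \<le> stop_loss \<nu> w"
          unfolding stop_loss_def by (intro integral_mono integrable_max) (auto simp: \<nu>)
        moreover have "(LINT y|\<nu>. y - w) = (LINT y|\<nu>. y) - w"
          by (subst Bochner_Integration.integral_diff) (auto simp: \<nu> \<nu>.prob_space[simplified])
        ultimately show False by (simp add: w_def)
      qed
      hence T: "measure \<mu> {x..} > 0" "measure \<nu> {x..} > 0"
        using pos stop_loss_eq_0[OF \<mu>(1), of x] stop_loss_eq_0[OF \<nu>(1), of x]
        by (auto simp: zero_less_measure_iff)
      have "stop_loss \<mu> x * measure \<nu> {x..} \<le> stop_loss \<nu> x * measure \<mu> {x..}"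
      proof (rule tendsto_lowerbound)
        show "((\<lambda>y. stop_loss \<nu> x * measure \<mu> {y..}) \<longlongrightarrow> stop_loss \<nu> x * measure \<mu> {x..}) (at_left x)"
          by (intro tendsto_intros measure_atLeast_left_continuous \<mu>)
        have "eventually (\<lambda>y. y < x) (at_left x)"
          by (simp add: eventually_at_filter)
        thus "\<forall>\<^sub>F y in at_left x.
            stop_loss \<mu> x * measure \<nu> {x..} \<le> stop_loss \<nu> x * measure \<mu> {y..}"
        proof eventually_elim
          case (elim y)
          have "stop_loss \<mu> x * (measure \<nu> {x..} * (x - y)) \<le>
              stop_loss \<mu> x * (stop_loss \<nu> y - stop_loss \<nu> x)"
            using elim by (intro mult_left_mono stop_loss_diff_bounds \<nu> stop_loss_nonneg) auto
          also have "\<dots> \<le> stop_loss \<nu> x * (stop_loss \<mu> y - stop_loss \<mu> x)"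
            using tp[rule_format, of y x] elim by (simp add: algebra_simps)
          also have "\<dots> \<le> stop_loss \<nu> x * (measure \<mu> {y..} * (x - y))"
            using elim by (intro mult_left_mono stop_loss_diff_bounds \<mu> stop_loss_nonneg) auto
          finally show ?case using elim by (simp flip: mult.assoc)
        qed
      qed simp
      thus ?thesis using T by (simp add: MRL_eq_stop_loss \<mu> \<nu> field_simps)
    qed
  qed
qed

section \<open>Composition of totally positive kernels\<close>

text \<open>The basic composition formula for two values of each outer variable: the product of two
  integrals over the middle variable is symmetrized over the pair \<open>(a, b)\<close>. For real values,
  \<open>(f\<^sub>1(a) f\<^sub>2(b) - f\<^sub>1(b) f\<^sub>2(a)) (g\<^sub>1(a) g\<^sub>2(b) - g\<^sub>1(b) g\<^sub>2(a)) \<ge> 0\<close>, since both factors are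
  nonnegative for \<open>a \<le> b\<close> and nonpositive for \<open>b \<le> a\<close>; the rearrangement inequality
  replaces this product for extended nonnegative values.\<close>

lemma TP2_composition:
  fixes f\<^sub>1 f\<^sub>2 g\<^sub>1 g\<^sub>2 :: "'a::linorder \<Rightarrow> ennreal"
  assumes [measurable]: "f\<^sub>1 \<in> borel_measurable N" "f\<^sub>2 \<in> borel_measurable N"
    "g\<^sub>1 \<in> borel_measurable N" "g\<^sub>2 \<in> borel_measurable N"
    and f: "\<And>a b. a \<in> space N \<Longrightarrow> b \<in> space N \<Longrightarrow> a \<le> b \<Longrightarrow> f\<^sub>1 b * f\<^sub>2 a \<le> f\<^sub>1 a * f\<^sub>2 b"
    and g: "\<And>a b. a \<in> space N \<Longrightarrow> b \<in> space N \<Longrightarrow> a \<le> b \<Longrightarrow> g\<^sub>1 b * g\<^sub>2 a \<le> g\<^sub>1 a * g\<^sub>2 b"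
  shows "(\<integral>\<^sup>+ a. f\<^sub>1 a * g\<^sub>2 a \<partial>N) * (\<integral>\<^sup>+ a. f\<^sub>2 a * g\<^sub>1 a \<partial>N) \<le>
         (\<integral>\<^sup>+ a. f\<^sub>1 a * g\<^sub>1 a \<partial>N) * (\<integral>\<^sup>+ a. f\<^sub>2 a * g\<^sub>2 a \<partial>N)"
proof -
  have rearrange: "u * s + v * r \<le> u * r + v * s" if "v \<le> u" "s \<le> r" for u v r s :: ennreal
  proof -
    from that obtain d e where "u = v + d" "r = s + e" unfolding le_iff_add by blast
    thus ?thesis by (auto simp: algebra_simps)
  qed
  have pt: "f\<^sub>1 a * g\<^sub>2 a * (f\<^sub>2 b * g\<^sub>1 b) + f\<^sub>2 a * g\<^sub>1 a * (f\<^sub>1 b * g\<^sub>2 b) \<le>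
        f\<^sub>1 a * g\<^sub>1 a * (f\<^sub>2 b * g\<^sub>2 b) + f\<^sub>2 a * g\<^sub>2 a * (f\<^sub>1 b * g\<^sub>1 b)"
    if "a \<in> space N" "b \<in> space N" for a b
  proof (cases "a \<le> b")
    case True
    from rearrange[OF f[OF that True] g[OF that True]] show ?thesis
      by (simp add: mult_ac add_ac)
  next
    case False
    hence "b \<le> a" by simp
    from rearrange[OF f[OF that(2,1) this] g[OF that(2,1) this]] show ?thesis
      by (simp add: mult_ac add_ac)
  qed
  let ?I = "\<lambda>f g. \<integral>\<^sup>+ a. f a * g a \<partial>N"
  have "(\<integral>\<^sup>+ a. \<integral>\<^sup>+ b. f\<^sub>1 a * g\<^sub>2 a * (f\<^sub>2 b * g\<^sub>1 b) + f\<^sub>2 a * g\<^sub>1 a * (f\<^sub>1 b * g\<^sub>2 b) \<partial>N \<partial>N) \<le>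
      (\<integral>\<^sup>+ a. \<integral>\<^sup>+ b. f\<^sub>1 a * g\<^sub>1 a * (f\<^sub>2 b * g\<^sub>2 b) + f\<^sub>2 a * g\<^sub>2 a * (f\<^sub>1 b * g\<^sub>1 b) \<partial>N \<partial>N)"
    by (intro nn_integral_mono pt)
  hence "?I f\<^sub>1 g\<^sub>2 * ?I f\<^sub>2 g\<^sub>1 + ?I f\<^sub>2 g\<^sub>1 * ?I f\<^sub>1 g\<^sub>2 \<le>
      ?I f\<^sub>1 g\<^sub>1 * ?I f\<^sub>2 g\<^sub>2 + ?I f\<^sub>2 g\<^sub>2 * ?I f\<^sub>1 g\<^sub>1"
    by (simp add: nn_integral_add nn_integral_cmult nn_integral_multc)
  hence "2 * (?I f\<^sub>1 g\<^sub>2 * ?I f\<^sub>2 g\<^sub>1) \<le> 2 * (?I f\<^sub>1 g\<^sub>1 * ?I f\<^sub>2 g\<^sub>2)"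
    by (simp add: mult_2 mult.commute)
  thus ?thesis by (subst (asm) ennreal_mult_le_mult_iff) auto
qed


section \<open>The MRL order for processes\<close>

text \<open>The stop-loss transform of the law of a random variable, with values in \<open>[0, \<infinity>]\<close>, so that averages of
  it need no integrability. The positive part is implicit, because \<open>ennreal\<close> maps negative reals to \<open>0\<close>.\<close>

definition excess :: "'a measure \<Rightarrow> ('a \<Rightarrow> real) \<Rightarrow> real \<Rightarrow> ennreal" where
  "excess M Z x = (\<integral>\<^sup>+ \<omega>. ennreal (Z \<omega> - x) \<partial>M)"

lemma mrl_process_iff_excess_TP2:
  assumes "prob_space M" and int: "\<And>t. t \<ge> 0 \<Longrightarrow> integrable M (Z t)"
  shows "mrl_process M Z \<longleftrightarrow>
    (\<forall>s t x y. 0 \<le> s \<longrightarrow> s \<le> t \<longrightarrow> x \<le> y \<longrightarrow>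
      excess M (Z s) y * excess M (Z t) x \<le> excess M (Z s) x * excess M (Z t) y)"
proof -
  interpret prob_space M by fact
  define \<mu> where "\<mu> t = distr M borel (Z t)" for t
  have rd: "real_distribution (\<mu> t)" and i: "integrable (\<mu> t) (\<lambda>y. y)" if "t \<ge> 0" for t
    using int[OF that] by (auto simp: \<mu>_def integrable_distr_eq intro!: real_distribution_distr)
  have excess: "excess M (Z t) x = ennreal (stop_loss (\<mu> t) x)" if "t \<ge> 0" for t x
    unfolding ennreal_stop_loss[OF rd[OF that] i[OF that]] excess_def unfolding \<mu>_def
    using int[OF that] by (subst nn_integral_distr) auto
  have "mrl_process M Z \<longleftrightarrow>
      (\<forall>s t. 0 \<le> s \<longrightarrow> s \<le> t \<longrightarrow> (\<forall>x. MRL (\<mu> s) x \<le> MRL (\<mu> t) x))"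
    using int by (auto simp: mrl_process_def \<mu>_def)
  also have "\<dots> \<longleftrightarrow> (\<forall>s t. 0 \<le> s \<longrightarrow> s \<le> t \<longrightarrow> (\<forall>x y. x \<le> y \<longrightarrow>
      stop_loss (\<mu> s) y * stop_loss (\<mu> t) x \<le> stop_loss (\<mu> s) x * stop_loss (\<mu> t) y))"
    by (intro all_cong1 imp_cong refl MRL_le_iff_stop_loss_TP2 rd i) auto
  also have "\<dots> \<longleftrightarrow> (\<forall>s t x y. 0 \<le> s \<longrightarrow> s \<le> t \<longrightarrow> x \<le> y \<longrightarrow>
      excess M (Z s) y * excess M (Z t) x \<le> excess M (Z s) x * excess M (Z t) y)"
    by (auto simp: excess stop_loss_nonneg simp flip: ennreal_mult)
  finally show ?thesis .
qed

section \<open>One-dimensional laws of a homogeneous Markov process\<close>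

lemma sets_generated_sigma:
  "sets (generated_sigma M S X T) =
    sigma_sets (space M) (\<Union>t\<in>T. {X t -` A \<inter> space M | A. A \<in> sets S})"
  unfolding generated_sigma_def by (rule sets_measure_of) auto

lemma subalgebra_generated_sigma:
  assumes "\<And>t. t \<in> T \<Longrightarrow> X t \<in> measurable M S"
  shows "subalgebra M (generated_sigma M S X T)"
  unfolding subalgebra_def
proof
  show "space (generated_sigma M S X T) = space M"
    unfolding generated_sigma_def by (rule space_measure_of) auto
  show "sets (generated_sigma M S X T) \<subseteq> sets M"
    unfolding sets_generated_sigma
    by (rule sets.sigma_sets_subset) (use assms in \<open>auto intro: measurable_sets\<close>)
qed

lemma markov_law_bind:
  assumes "prob_space M" and markov: "homogeneous_markov_process M S X P"
    and s: "0 \<le> s" and t: "0 < t"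
  shows "distr M S (X (s + t)) = distr M S (X s) \<bind> P t"
proof -
  interpret prob_space M by fact
  have X: "X r \<in> measurable M S" if "r \<ge> 0" for r
    using markov that by (auto simp: homogeneous_markov_process_def)
  note [measurable] = X[OF s] X[of "s + t"]
  have P: "P t \<in> measurable S (prob_algebra S)"
    using markov t by (auto simp: homogeneous_markov_process_def)
  hence P': "P t \<in> measurable S (subprob_algebra S)" by (rule measurable_prob_algebraD)
  define F where "F = generated_sigma M S X {0..s}"
  interpret F: finite_measure_subalgebra M F
    by standard (auto simp: F_def intro!: subalgebra_generated_sigma X)
  have ne: "space (distr M S (X s)) \<noteq> {}"
    using measurable_space[OF X[OF s]] not_empty by auto
  show ?thesis
  proof (rule measure_eqI)
    show "sets (distr M S (X (s + t))) = sets (distr M S (X s) \<bind> P t)"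
      by (subst sets_bind[of _ _ S]) (use ne sets_kernel[OF P'] in auto)
  next
    fix A assume "A \<in> sets (distr M S (X (s + t)))"
    hence A [measurable]: "A \<in> sets S" by simp
    have [measurable]: "X (s + t) \<in> measurable M S" using s t by (intro X) auto
    have int: "integrable M (\<lambda>\<omega>. indicator A (X (s + t) \<omega>) :: real)"
      by (intro integrable_const_bound[of _ 1]) auto
    have prob_P: "prob_space (P t (X s \<omega>))" if "\<omega> \<in> space M" for \<omega>
      using measurable_space[OF P measurable_space[OF X[OF s] that]]
      by (simp add: space_prob_algebra)
    have meas [measurable]: "(\<lambda>\<omega>. measure (P t (X s \<omega>)) A) \<in> borel_measurable M"
      unfolding measure_def using X[OF s] P' A
      by (auto intro!: borel_measurable_enn2real measurable_compose[OF _ measurable_emeasure_subprob_algebra])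
    have "emeasure (distr M S (X (s + t))) A = ennreal (measure M (X (s + t) -` A \<inter> space M))"
      using s t by (simp add: emeasure_distr emeasure_eq_measure)
    also have "measure M (X (s + t) -` A \<inter> space M) = (LINT \<omega>|M. indicator A (X (s + t) \<omega>))"
    proof -
      have "(LINT \<omega>|M. indicator A (X (s + t) \<omega>)) =
          (LINT \<omega>|M. indicator (X (s + t) -` A \<inter> space M) \<omega> :: real)"
        by (intro Bochner_Integration.integral_cong) (auto simp: indicator_def)
      thus ?thesis by simp
    qed
    also have "\<dots> = (LINT \<omega>|M. real_cond_exp M F (\<lambda>\<omega>. indicator A (X (s + t) \<omega>)) \<omega>)"
      by (rule F.real_cond_exp_int(2)[OF int, symmetric])
    also have "\<dots> = (LINT \<omega>|M. measure (P t (X s \<omega>)) A)"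
      using markov s t A by (intro integral_cong_AE)
        (auto simp: homogeneous_markov_process_def F_def)
    also have "ennreal \<dots> = (\<integral>\<^sup>+ \<omega>. ennreal (measure (P t (X s \<omega>)) A) \<partial>M)"
      by (intro nn_integral_eq_integral[symmetric] integrable_const_bound[of _ 1])
        (auto intro!: AE_I2 prob_space.prob_le_1 prob_P)
    also have "\<dots> = (\<integral>\<^sup>+ \<omega>. emeasure (P t (X s \<omega>)) A \<partial>M)"
      by (intro nn_integral_cong)
        (simp add: finite_measure.emeasure_eq_measure prob_P prob_space.finite_measure)
    also have "\<dots> = (\<integral>\<^sup>+ \<theta>. emeasure (P t \<theta>) A \<partial>distr M S (X s))"
      using P' by (subst nn_integral_distr)
        (auto intro: measurable_compose[OF _ measurable_emeasure_subprob_algebra])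
    also have "\<dots> = emeasure (distr M S (X s) \<bind> P t) A"
      using P' ne by (subst emeasure_bind[where N = S]) auto
    finally show "emeasure (distr M S (X (s + t))) A = emeasure (distr M S (X s) \<bind> P t) A" .
  qed
qed

lemma markov_law_started_at:
  assumes "prob_space M" and markov: "homogeneous_markov_process M S X P"
    and start: "AE \<omega> in M. X 0 \<omega> = z" and z: "z \<in> space S" and t: "0 < t"
  shows "distr M S (X t) = P t z"
proof -
  interpret prob_space M by fact
  have [measurable]: "X 0 \<in> measurable M S" and P: "P t \<in> measurable S (prob_algebra S)"
    using markov t by (auto simp: homogeneous_markov_process_def)
  have "distr M S (X 0) = distr M S (\<lambda>_. z)"
    using z by (intro distr_cong_AE start) auto
  also have "\<dots> = return S z"
    by (rule distr_const[OF z])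
  finally have "distr M S (X (0 + t)) = return S z \<bind> P t"
    using markov_law_bind[OF assms(1,2) order_refl t] by simp
  also have "\<dots> = P t z"
    using measurable_prob_algebraD[OF P] z by (rule bind_return)
  finally show ?thesis by simp
qed

section \<open>Evaluation of a process at an independent random time\<close>

text \<open>A random element \<open>T\<close> that is independent of \<open>G\<close> is paired with the identity map into the measurable
  space \<open>G\<close>, so that \<open>Y (T \<omega>) \<omega>\<close> becomes a measurable function of two independent variables.\<close>

lemma distr_pair_independent:
  assumes "prob_space M" and G: "subalgebra M G" and T [measurable]: "T \<in> measurable M S"
    and H: "{T -` A \<inter> space M | A. A \<in> sets S} \<subseteq> H"
    and indep: "prob_space.indep_set M H (sets G)"
  shows "distr M (S \<Otimes>\<^sub>M G) (\<lambda>\<omega>. (T \<omega>, \<omega>)) = distr M S T \<Otimes>\<^sub>M distr M G (\<lambda>\<omega>. \<omega>)"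
proof -
  interpret prob_space M by fact
  have id: "(\<lambda>\<omega>. \<omega>) \<in> measurable M G"
    using measurable_from_subalg[OF G, of "\<lambda>\<omega>. \<omega>" G] by simp
  have space: "space G = space M" using G by (simp add: subalgebra_def)
  interpret G: prob_space "distr M G (\<lambda>\<omega>. \<omega>)" by (rule prob_space_distr) fact
  interpret T: prob_space "distr M S T" by (rule prob_space_distr) fact
  have pair: "(\<lambda>\<omega>. (T \<omega>, \<omega>)) \<in> measurable M (S \<Otimes>\<^sub>M G)" using id by measurable
  show ?thesis
  proof (rule pair_measure_eqI[symmetric])
    fix A B assume "A \<in> sets (distr M S T)" "B \<in> sets (distr M G (\<lambda>\<omega>. \<omega>))"
    hence A: "A \<in> sets S" and B: "B \<in> sets G" by auto
    have "T -` A \<inter> space M \<in> H" using A H by auto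
    with indep B have "prob ((T -` A \<inter> space M) \<inter> B) = prob (T -` A \<inter> space M) * prob B"
      by (intro indep_setD)
    moreover have "(\<lambda>\<omega>. (T \<omega>, \<omega>)) -` (A \<times> B) \<inter> space M = (T -` A \<inter> space M) \<inter> B"
      by auto
    moreover have "(\<lambda>\<omega>. \<omega>) -` B \<inter> space M = B"
      using sets.sets_into_space[OF B] by (auto simp: space)
    ultimately show "emeasure (distr M S T) A * emeasure (distr M G (\<lambda>\<omega>. \<omega>)) B =
        emeasure (distr M (S \<Otimes>\<^sub>M G) (\<lambda>\<omega>. (T \<omega>, \<omega>))) (A \<times> B)"
      using A B id pair by (simp add: emeasure_distr emeasure_eq_measure ennreal_mult)
  qed (auto cong: sets_pair_measure_cong intro: G.sigma_finite_measure_axioms T.sigma_finite_measure_axioms)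
qed

text \<open>The hypothesis \<open>law\<close> expresses that \<open>T\<close> is independent of \<open>G\<close>; the integral of \<open>Y (T \<omega>) \<omega>\<close> is then
  an iterated integral, first over \<open>\<omega>\<close> with the time frozen, and then over the law of \<open>T\<close>.\<close>

lemma
  fixes Y :: "'b \<Rightarrow> 'a \<Rightarrow> real"
  assumes "prob_space M" and G: "subalgebra M G" and T [measurable]: "T \<in> measurable M S"
    and Y: "(\<lambda>(l, \<omega>). Y l \<omega>) \<in> borel_measurable (S \<Otimes>\<^sub>M G)"
    and law: "distr M (S \<Otimes>\<^sub>M G) (\<lambda>\<omega>. (T \<omega>, \<omega>)) = distr M S T \<Otimes>\<^sub>M distr M G (\<lambda>\<omega>. \<omega>)"
  shows measurable_excess_family: "(\<lambda>l. excess M (Y l) x) \<in> borel_measurable S"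
    and excess_at_independent_time:
      "excess M (\<lambda>\<omega>. Y (T \<omega>) \<omega>) x = (\<integral>\<^sup>+ l. excess M (Y l) x \<partial>distr M S T)"
    and integral_at_independent_time:
      "integrable M (\<lambda>\<omega>. Y (T \<omega>) \<omega>) \<Longrightarrow>
        (LINT \<omega>|M. Y (T \<omega>) \<omega>) = (LINT l|distr M S T. LINT \<omega>|M. Y l \<omega>)"
proof -
  interpret prob_space M by fact
  have id [measurable]: "(\<lambda>\<omega>. \<omega>) \<in> measurable M G"
    using measurable_from_subalg[OF G, of "\<lambda>\<omega>. \<omega>" G] by simp
  interpret G: prob_space "distr M G (\<lambda>\<omega>. \<omega>)" by (rule prob_space_distr) fact
  interpret T: prob_space "distr M S T" by (rule prob_space_distr) fact
  interpret pair_sigma_finite "distr M S T" "distr M G (\<lambda>\<omega>. \<omega>)" ..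
  have pair [measurable]: "(\<lambda>\<omega>. (T \<omega>, \<omega>)) \<in> measurable M (S \<Otimes>\<^sub>M G)" by measurable
  have Y_sec: "Y l \<in> borel_measurable G" if "l \<in> space S" for l
    using measurable_compose[OF measurable_Pair1'[OF that] Y] by simp
  have Yx [measurable]: "(\<lambda>(l, \<omega>). ennreal (Y l \<omega> - x)) \<in> borel_measurable (S \<Otimes>\<^sub>M G)"
    using Y by (simp add: case_prod_unfold)
  have excess: "excess M (Y l) x = (\<integral>\<^sup>+ \<omega>. ennreal (Y l \<omega> - x) \<partial>distr M G (\<lambda>\<omega>. \<omega>))"
    if "l \<in> space S" for l
    using Y_sec[OF that] id by (simp add: excess_def nn_integral_distr)
  have "(\<lambda>l. \<integral>\<^sup>+ \<omega>. ennreal (Y l \<omega> - x) \<partial>distr M G (\<lambda>\<omega>. \<omega>)) \<in> borel_measurable S"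
    using G.borel_measurable_nn_integral_fst[of "\<lambda>(l, \<omega>). ennreal (Y l \<omega> - x)" S] Yx
    by (simp cong: measurable_cong_sets)
  thus "(\<lambda>l. excess M (Y l) x) \<in> borel_measurable S"
    using excess by (simp cong: measurable_cong)
  have "excess M (\<lambda>\<omega>. Y (T \<omega>) \<omega>) x =
      (\<integral>\<^sup>+ (l, \<omega>). ennreal (Y l \<omega> - x) \<partial>distr M (S \<Otimes>\<^sub>M G) (\<lambda>\<omega>. (T \<omega>, \<omega>)))"
    by (subst nn_integral_distr) (auto simp: excess_def)
  also have "\<dots> = (\<integral>\<^sup>+ l. \<integral>\<^sup>+ \<omega>. ennreal (Y l \<omega> - x) \<partial>distr M G (\<lambda>\<omega>. \<omega>) \<partial>distr M S T)"
    unfolding law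
    by (subst G.nn_integral_fst[symmetric]) (auto cong: measurable_cong_sets)
  also have "\<dots> = (\<integral>\<^sup>+ l. excess M (Y l) x \<partial>distr M S T)"
    by (intro nn_integral_cong) (simp add: excess)
  finally show "excess M (\<lambda>\<omega>. Y (T \<omega>) \<omega>) x = (\<integral>\<^sup>+ l. excess M (Y l) x \<partial>distr M S T)" .
  assume int: "integrable M (\<lambda>\<omega>. Y (T \<omega>) \<omega>)"
  have "integrable (distr M (S \<Otimes>\<^sub>M G) (\<lambda>\<omega>. (T \<omega>, \<omega>))) (\<lambda>(l, \<omega>). Y l \<omega>)"
    using int by (subst integrable_distr_eq) (auto intro: Y)
  hence int': "integrable (distr M S T \<Otimes>\<^sub>M distr M G (\<lambda>\<omega>. \<omega>)) (\<lambda>(l, \<omega>). Y l \<omega>)"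
    by (simp add: law)
  have "(LINT \<omega>|M. Y (T \<omega>) \<omega>) =
      (LINT z|distr M (S \<Otimes>\<^sub>M G) (\<lambda>\<omega>. (T \<omega>, \<omega>)). (\<lambda>(l, \<omega>). Y l \<omega>) z)"
    by (subst integral_distr) (auto intro: Y)
  also have "\<dots> = (LINT l|distr M S T. LINT \<omega>|distr M G (\<lambda>\<omega>. \<omega>). Y l \<omega>)"
    unfolding law using integral_fst'[OF int'] by simp
  also have "\<dots> = (LINT l|distr M S T. LINT \<omega>|M. Y l \<omega>)"
    by (rule Bochner_Integration.integral_cong[OF refl]) (simp add: integral_distr[OF id Y_sec])
  finally show "(LINT \<omega>|M. Y (T \<omega>) \<omega>) = (LINT l|distr M S T. LINT \<omega>|M. Y l \<omega>)" .
qed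

section \<open>Subordination preserves centered MRL processes\<close>

theorem theorem4p7:
  fixes M :: "'a measure"
    and Y :: "real \<Rightarrow> 'a \<Rightarrow> real"
    and \<Lambda> :: "real \<Rightarrow> 'a \<Rightarrow> real"
    and P :: "real \<Rightarrow> real \<Rightarrow> real measure"
    and p :: "real \<Rightarrow> real \<Rightarrow> real \<Rightarrow> real"
  assumes "prob_space M"
    and Y_mrl: "mrl_process M Y"
    and Y_centered: "centered_process M Y"
    and markov: "homogeneous_markov_process M Rplus \<Lambda> P"
    and right_cont: "right_continuous_process M \<Lambda>"
    and start: "AE \<omega> in M. \<Lambda> 0 \<omega> = 0"
    and kernel_density: "\<And>t \<theta>. t > 0 \<Longrightarrow> \<theta> \<ge> 0 \<Longrightarrow>
          P t \<theta> = density (restrict_space lborel {0..}) (\<lambda>l. ennreal (p t \<theta> l))"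
    and kernel_continuous: "\<And>t. t > 0 \<Longrightarrow>
          continuous_on ({0..} \<times> {0..}) (\<lambda>(\<theta>, l). p t \<theta> l)"
    and kernel_TP2: "\<And>t. t > 0 \<Longrightarrow> TP2_on {0..} {0..} (p t)"
    and indep: "independent_processes M \<Lambda> Y"
    and X_integrable: "\<And>t. t \<ge> 0 \<Longrightarrow> integrable M (\<lambda>\<omega>. Y (\<Lambda> t \<omega>) \<omega>)"
  shows "mrl_process M (\<lambda>t \<omega>. Y (\<Lambda> t \<omega>) \<omega>) \<and> centered_process M (\<lambda>t \<omega>. Y (\<Lambda> t \<omega>) \<omega>)"
proof -
  interpret prob_space M by fact
  obtain G where G: "subalgebra M G"
    and Y_meas: "(\<lambda>(l, \<omega>). Y l \<omega>) \<in> borel_measurable (Rplus \<Otimes>\<^sub>M G)"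
    and ind: "indep_set (sets (generated_sigma M Rplus \<Lambda> {0..})) (sets G)"
    using indep unfolding independent_processes_def by blast
  define \<nu> where "\<nu> t = distr M Rplus (\<Lambda> t)" for t
  have \<Lambda>: "\<Lambda> t \<in> measurable M Rplus" if "t \<ge> 0" for t
    using markov that by (auto simp: homogeneous_markov_process_def)
  have space_\<nu> [simp]: "space (\<nu> t) = {0..}" for t
    by (simp add: \<nu>_def space_restrict_space)
  have joint: "distr M (Rplus \<Otimes>\<^sub>M G) (\<lambda>\<omega>. (\<Lambda> t \<omega>, \<omega>)) = \<nu> t \<Otimes>\<^sub>M distr M G (\<lambda>\<omega>. \<omega>)"
    if "t \<ge> 0" for t
    unfolding \<nu>_def
    by (rule distr_pair_independent[OF \<open>prob_space M\<close> G \<Lambda>[OF that] _ ind])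
      (use that in \<open>auto simp: sets_generated_sigma intro!: sigma_sets.Basic\<close>)
  note at_time = \<open>prob_space M\<close> G \<Lambda> Y_meas joint[unfolded \<nu>_def]
  let ?X = "\<lambda>t \<omega>. Y (\<Lambda> t \<omega>) \<omega>"
  have c_meas [measurable]: "(\<lambda>l. excess M (Y l) x) \<in> borel_measurable Rplus" for x
    by (rule measurable_excess_family[OF at_time]) (rule order_refl)+
  have X: "excess M (?X t) x = (\<integral>\<^sup>+ l. excess M (Y l) x \<partial>\<nu> t)" if "t \<ge> 0" for t x
    unfolding \<nu>_def using that by (intro excess_at_independent_time[OF at_time])
  have Y_int: "integrable M (Y t)" if "t \<ge> 0" for t
    using Y_mrl that by (simp add: mrl_process_def)
  have Y_TP2: "excess M (Y a) y * excess M (Y b) x \<le> excess M (Y a) x * excess M (Y b) y"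
    if "0 \<le> a" "a \<le> b" "x \<le> y" for a b x y
    using mrl_process_iff_excess_TP2[OF \<open>prob_space M\<close> Y_int, THEN iffD1, OF _ Y_mrl] that by simp

  have "excess M (?X s) y * excess M (?X t) x \<le> excess M (?X s) x * excess M (?X t) y"
    if st: "0 \<le> s" "s < t" and xy: "x \<le> y" for s t x y
  proof (cases "s = 0")
    case True
    have X0: "excess M (?X 0) u = excess M (Y 0) u" for u
      unfolding excess_def by (intro nn_integral_cong_AE) (use start in auto)
    have "excess M (?X s) y * excess M (?X t) x =
        (\<integral>\<^sup>+ l. excess M (Y 0) y * excess M (Y l) x \<partial>\<nu> t)"
      using st by (simp add: True X0 X \<nu>_def nn_integral_cmult)
    also have "\<dots> \<le> (\<integral>\<^sup>+ l. excess M (Y 0) x * excess M (Y l) y \<partial>\<nu> t)"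
      using xy by (intro nn_integral_mono Y_TP2) auto
    also have "\<dots> = excess M (?X s) x * excess M (?X t) y"
      using st by (simp add: True X0 X \<nu>_def nn_integral_cmult)
    finally show ?thesis .
  next
    case False
    with st have s: "s > 0" by simp
    let ?N = "restrict_space lborel {0..} :: real measure"
    have sets_N: "sets ?N = sets Rplus"
      by (intro sets_restrict_space_cong) simp
    have P: "P s \<in> measurable Rplus (subprob_algebra Rplus)"
      using markov s by (auto simp: homogeneous_markov_process_def intro: measurable_prob_algebraD)
    define A where "A \<theta> u = (\<integral>\<^sup>+ l. excess M (Y l) u \<partial>P s \<theta>)" for \<theta> u
    have A_meas [measurable]: "(\<lambda>\<theta>. A \<theta> u) \<in> borel_measurable (\<nu> r)" for r u
      unfolding A_def \<nu>_def measurable_distr_eq1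
      by (rule measurable_compose[OF P nn_integral_measurable_subprob_algebra]) measurable
    have A_0: "excess M (?X s) u = A 0 u" for u
      using s markov_law_started_at[OF \<open>prob_space M\<close> markov start _ s]
      by (simp add: X A_def \<nu>_def space_restrict_space)
    have "\<nu> t = \<nu> (t - s) \<bind> P s"
      using markov_law_bind[OF \<open>prob_space M\<close> markov _ s, of "t - s"] st by (simp add: \<nu>_def)
    hence A_t: "excess M (?X t) u = (\<integral>\<^sup>+ \<theta>. A \<theta> u \<partial>\<nu> (t - s))" for u
      using st P by (simp add: X A_def nn_integral_bind[of _ Rplus] \<nu>_def)
    \<comment> \<open>Here \<open>\<theta>\<close> is a possible value of \<open>\<Lambda>\<close> at time \<open>t - s\<close>, and \<open>0\<close> is the starting point.\<close>
    have A_TP2: "A 0 y * A \<theta> x \<le> A 0 x * A \<theta> y" if \<theta>: "\<theta> \<ge> 0" for \<theta>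
    proof -
      have p_meas: "(\<lambda>l. ennreal (p s z l)) \<in> borel_measurable ?N" if "z \<ge> 0" for z
      proof -
        have "continuous_on {0..} (\<lambda>l::real. (z, l))"
          by (intro continuous_on_Pair continuous_on_const continuous_on_id)
        hence "continuous_on {0..} (\<lambda>l. p s z l)"
          using continuous_on_compose2[OF kernel_continuous[OF s], of "{0..}" "\<lambda>l. (z, l)"] that
          by auto
        hence "(\<lambda>l. p s z l) \<in> borel_measurable Rplus"
          by (rule borel_measurable_continuous_on_restrict)
        thus ?thesis by (simp cong: measurable_cong_sets add: sets_N)
      qed
      have c_N: "(\<lambda>l. excess M (Y l) u) \<in> borel_measurable ?N" for u
        using c_meas[of u] by (simp cong: measurable_cong_sets add: sets_N)
      have A: "A z u = (\<integral>\<^sup>+ l. ennreal (p s z l) * excess M (Y l) u \<partial>?N)" if "z \<ge> 0" for z u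
        unfolding A_def kernel_density[OF s that]
        by (rule nn_integral_density[OF p_meas[OF that] c_N])
      have p_TP2: "ennreal (p s 0 b) * ennreal (p s \<theta> a) \<le> ennreal (p s 0 a) * ennreal (p s \<theta> b)"
        if "0 \<le> a" "a \<le> b" for a b
        using kernel_TP2[OF s] that \<theta> unfolding TP2_on_def
        by (auto simp flip: ennreal_mult intro!: ennreal_leI)
      show ?thesis
        unfolding A[OF order_refl] A[OF \<theta>]
        by (rule TP2_composition)
          (use p_meas \<theta> c_N p_TP2 Y_TP2 xy in \<open>auto simp: space_restrict_space mult.commute\<close>)
    qed
    have "excess M (?X s) y * excess M (?X t) x = (\<integral>\<^sup>+ \<theta>. A 0 y * A \<theta> x \<partial>\<nu> (t - s))"
      by (simp add: A_0 A_t nn_integral_cmult)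
    also have "\<dots> \<le> (\<integral>\<^sup>+ \<theta>. A 0 x * A \<theta> y \<partial>\<nu> (t - s))"
      by (intro nn_integral_mono A_TP2) auto
    also have "\<dots> = excess M (?X s) x * excess M (?X t) y"
      by (simp add: A_0 A_t nn_integral_cmult)
    finally show ?thesis .
  qed
  hence "excess M (?X s) y * excess M (?X t) x \<le> excess M (?X s) x * excess M (?X t) y"
    if "0 \<le> s" "s \<le> t" "x \<le> y" for s t x y
    using that by (cases "s = t") (auto simp: mult.commute)
  hence "mrl_process M ?X"
    by (subst mrl_process_iff_excess_TP2[OF \<open>prob_space M\<close> X_integrable]) auto
  moreover have "centered_process M ?X"
    unfolding centered_process_def
  proof (intro allI impI)
    fix t :: real assume t: "0 \<le> t"
    have "(LINT \<omega>|M. ?X t \<omega>) = (LINT l|\<nu> t. LINT \<omega>|M. Y l \<omega>)"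
      unfolding \<nu>_def by (rule integral_at_independent_time[OF at_time]) (use t X_integrable in auto)
    also have "\<dots> = (LINT l|\<nu> t. 0)"
      by (intro Bochner_Integration.integral_cong refl)
        (use Y_centered in \<open>auto simp: centered_process_def\<close>)
    finally show "integral\<^sup>L M (?X t) = 0" by simp
  qed
  ultimately show ?thesis ..
qed

end
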